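(* For $n\ge m\ge 1$ let $r_n(m)$ be the number of members of $\mathcal{C}_n(21\text{-}1)$ having largest letter $m$, and let $R(t;v)=\sum_{n\geq1}\sum_{m=1}^n r_n(m)t^nv^{m-1}$. Then $$R(t;v)=\dfrac{t}{v(1-2t)-\dfrac{(1-t)^2\bigl(vt^2-(1-v)(1-2t)\bigr)}{(1-t)(1-2t)-vt^3R\left(t;\frac{vt}{1-t}\right)}}.$$ In particular, $\sum_{n\geq1}c_n(21\text{-}1)t^n=R(t;1)=t+2t^2+5t^3+13t^4+35t^5+96t^6+267t^7+750t^8+2122t^9+6036t^{10}+17239t^{11}+49389t^{12}+141842t^{13}+408142t^{14}+1176194t^{15}+3393726t^{16}+9801731t^{17}+28331971t^{18}+81947397t^{19}+237152119t^{20}+\cdots$.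
   Context: A Catalan word of length $n\ge 1$ is a sequence $\pi=\pi_1\cdots\pi_n$ of positive integers with $\pi_1=1$ and $\pi_{i+1}\le \pi_i+1$ for $1\le i\le n-1$; $\mathcal{C}_n$ is the set of these. A word $\pi$ contains the vincular pattern $21\text{-}1$ if there are indices $i,j$ with $i+1<j\le n$ such that $\pi_i>\pi_{i+1}=\pi_j$; otherwise $\pi$ avoids it. $\mathcal{C}_n(21\text{-}1)$ is the set of members of $\mathcal{C}_n$ avoiding $21\text{-}1$, and $c_n(21\text{-}1)=|\mathcal{C}_n(21\text{-}1)|$. Identities are of power series in $t$ whose coefficients are polynomials in $v$ (expressions expanded about $t=0$). *)

theory Defs
  imports "HOL-Computational_Algebra.Computational_Algebra"
begin

text \<open>Words are lists, so the letter with index \<open>i\<close> in the usual 1-based notation is \<open>w ! (i - 1)\<close>.\<close>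

definition catalan_words :: "nat \<Rightarrow> nat list set" where
  "catalan_words n = {w. length w = n \<and> w \<noteq> [] \<and> (\<forall>x\<in>set w. x \<ge> 1) \<and> w ! 0 = 1 \<and>
     (\<forall>i. i + 1 < n \<longrightarrow> w ! (i + 1) \<le> w ! i + 1)}"

definition contains_21_1 :: "nat list \<Rightarrow> bool" where
  "contains_21_1 w \<longleftrightarrow>
     (\<exists>i j. i + 1 < j \<and> j < length w \<and> w ! i > w ! (i + 1) \<and> w ! (i + 1) = w ! j)"

definition avoiding_words :: "nat \<Rightarrow> nat list set" where
  "avoiding_words n = {w \<in> catalan_words n. \<not> contains_21_1 w}"

definition avoiding_count :: "nat \<Rightarrow> nat" where
  "avoiding_count n = card (avoiding_words n)"

definition avoiding_max_count :: "nat \<Rightarrow> nat \<Rightarrow> nat" where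
  "avoiding_max_count n m = card {w \<in> avoiding_words n. Max (set w) = m}"

text \<open>
  \<open>R_gf v\<close> is \<open>R(t;v)\<close>, where \<open>t\<close> is \<^const>\<open>fps_X\<close> and the second argument may be any power series
  in \<open>t\<close>, so that \<open>R(t;v)\<close> for an indeterminate \<open>v\<close>, \<open>R(t;vt/(1-t))\<close> and \<open>R(t;1)\<close> are all
  values of the same function. The outer sum is a limit in the \<open>t\<close>-adic topology; it always
  converges (lemma \<open>R_gf_sums\<close>). The summation index is shifted so that it starts at 1.
\<close>

definition R_gf :: "'a::comm_ring_1 fps \<Rightarrow> 'a fps" where
  "R_gf v = (\<Sum>n. \<Sum>m=1..Suc n. of_nat (avoiding_max_count (Suc n) m) * fps_X ^ Suc n * v ^ (m - 1))"

text \<open>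
  The indeterminate \<open>v\<close>, as a constant power series. Coefficients are taken in the field of
  fractions of \<open>\<int>[v]\<close> in order to have division of power series available.
\<close>

definition v_indet :: "int poly fract fps" where
  "v_indet = fps_const (to_fract [:0, 1:])"

lemma fps_sums_X_power_mult:
  fixes a :: "nat \<Rightarrow> 'a::comm_ring_1 fps"
  shows "(\<lambda>n. fps_X ^ n * a n) sums Abs_fps (\<lambda>k. \<Sum>n\<le>k. (fps_X ^ n * a n) $ k)"
  unfolding sums_def
proof (rule tendsto_fpsI)
  fix k
  show "\<forall>\<^sub>F N in sequentially. (\<Sum>n<N. fps_X ^ n * a n) $ k =
          Abs_fps (\<lambda>k. \<Sum>n\<le>k. (fps_X ^ n * a n) $ k) $ k"
    using eventually_gt_at_top[of k]
  proof eventually_elim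
    case (elim N)
    have "(\<Sum>n<N. (fps_X ^ n * a n) $ k) = (\<Sum>n\<le>k. (fps_X ^ n * a n) $ k)"
      by (rule sum.mono_neutral_right) (use elim in \<open>auto simp: fps_X_power_mult_nth\<close>)
    thus ?case by (simp add: fps_sum_nth)
  qed
qed

lemma R_gf_sums:
  "(\<lambda>n. \<Sum>m=1..Suc n. of_nat (avoiding_max_count (Suc n) m) * fps_X ^ Suc n * v ^ (m - 1)) sums R_gf v"
proof -
  let ?f = "\<lambda>n. \<Sum>m=1..Suc n. of_nat (avoiding_max_count (Suc n) m) * fps_X ^ Suc n * v ^ (m - 1)"
  let ?a = "\<lambda>n. \<Sum>m=1..Suc n. of_nat (avoiding_max_count (Suc n) m) * fps_X * v ^ (m - 1)"
  have "?f = (\<lambda>n. fps_X ^ n * ?a n)"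
    by (rule ext) (simp only: sum_distrib_left power_Suc mult_ac)
  hence "summable ?f"
    using fps_sums_X_power_mult[of ?a] by (simp only: sums_iff)
  thus ?thesis unfolding R_gf_def by (rule summable_sums)
qed

end

theory Submission
  imports Defs
begin

text \<open>
  The first letter of a word is peeled off. An avoiding word is \<open>1\<close>, or \<open>1\<close> followed by an avoiding
  word, or \<open>1\<close> followed by a word whose letters before its first \<open>1\<close> (if there is one) are an
  avoiding word \<open>u\<close> raised by one. In the last case that \<open>1\<close> is a descent bottom, so it is the
  last \<open>1\<close>, and what follows it is empty or again an avoiding word \<open>u'\<close> raised by one
  (\<open>avoiders_decomposition\<close>). The parts \<open>u\<close> and \<open>u'\<close> interact only in that no descent bottom of \<open>u\<close>
  may occur in \<open>u'\<close>. Since \<open>u'\<close> uses every letter from \<open>1\<close> to its maximum \<open>m\<close>, the condition depends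
  on \<open>m\<close> only: the descent bottoms of \<open>u\<close> must exceed \<open>m\<close>.
  
  A word with that property starts as a weakly increasing run through \<open>1, 2, ...\<close> which either stops
  at some letter \<open>\<le> m\<close> or passes \<open>m\<close> and goes on as an arbitrary avoiding word raised by \<open>m\<close>. Each
  letter of the run occurs at least once, contributing \<open>s = t/(1 - t)\<close>. Hence the weight of all
  such \<open>u\<close> is a combination of \<open>v ^ (m - 1)\<close> and \<open>(v s) ^ (m - 1)\<close>
  (\<open>avoiders_above_gf_closed_form\<close>), and summing it over \<open>u'\<close> produces \<open>R(t;v)\<close> and \<open>R(t;vs)\<close>. This
  is where the shifted argument comes from. The outcome is a polynomial relation between \<open>R(t;v)\<close>
  and \<open>R(t;vs)\<close>, valid over every commutative ring (\<open>R_gf_functional_equation\<close>); over a field it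
  can be solved for \<open>R(t;v)\<close>, which gives the stated fraction.
  
  For the coefficients of \<open>R(t;1)\<close> the relation is used with \<open>v = s ^ j\<close>. There \<open>R(t;s ^ (j + 1))\<close>
  enters multiplied by \<open>t ^ (j + 4)\<close>, so each step gains \<open>j + 4\<close> correct coefficients, and starting
  from no information at \<open>j = 4\<close> suffices to reach \<open>t ^ 20\<close> at \<open>j = 0\<close> (\<open>R_gf_1_truncation\<close>).
\<close>

section \<open>Weighted generating functions of graded sets\<close>

definition finite_levels :: "('b \<Rightarrow> nat) \<Rightarrow> 'b set \<Rightarrow> bool" where
  "finite_levels sz A \<longleftrightarrow> (\<forall>N. finite {x \<in> A. sz x \<le> N})"

text \<open>
  The series \<open>\<Sum>x\<in>A. t ^ sz x * f x\<close>, where the weights are themselves power series in \<open>t\<close>. It is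
  defined coefficientwise: elements of size larger than \<open>k\<close> cannot contribute to the coefficient of
  \<open>t ^ k\<close>, so each coefficient is a finite sum as soon as every size occurs finitely often.
\<close>

definition weight_gf :: "('b \<Rightarrow> nat) \<Rightarrow> 'b set \<Rightarrow> ('b \<Rightarrow> 'a::comm_ring_1 fps) \<Rightarrow> 'a fps" where
  "weight_gf sz A f = Abs_fps (\<lambda>k. \<Sum>x | x \<in> A \<and> sz x \<le> k. (fps_X ^ sz x * f x) $ k)"

lemma weight_gf_nth:
  "weight_gf sz A f $ k = (\<Sum>x | x \<in> A \<and> sz x \<le> k. (fps_X ^ sz x * f x) $ k)"
  by (simp add: weight_gf_def)

text \<open>
  Up to any fixed order the series is an honest finite sum of power series, which transfers
  identities between finite sums to \<open>weight_gf\<close>.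
\<close>

lemma weight_gf_nth_truncation:
  assumes "finite_levels sz A" "k \<le> N"
  shows "weight_gf sz A f $ k = (\<Sum>x | x \<in> A \<and> sz x \<le> N. fps_X ^ sz x * f x) $ k"
  unfolding weight_gf_nth fps_sum_nth
  by (rule sum.mono_neutral_left)
     (use assms in \<open>auto simp: finite_levels_def fps_X_power_mult_nth\<close>)

lemma finite_levels_subset: "finite_levels sz B \<Longrightarrow> A \<subseteq> B \<Longrightarrow> finite_levels sz A"
  unfolding finite_levels_def by (auto intro: finite_subset[of _ "{x \<in> B. sz x \<le> N}" for N])

lemma weight_gf_cong:
  "(\<And>x. x \<in> A \<Longrightarrow> f x = g x) \<Longrightarrow> weight_gf sz A f = weight_gf sz A g"
  unfolding weight_gf_def by (intro arg_cong[where f = Abs_fps] ext sum.cong) auto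

lemma weight_gf_Un:
  assumes "finite_levels sz (A \<union> B)" "A \<inter> B = {}"
  shows "weight_gf sz (A \<union> B) f = weight_gf sz A f + weight_gf sz B f"
proof (rule fps_ext)
  fix k
  have "{x. x \<in> A \<union> B \<and> sz x \<le> k} = {x. x \<in> A \<and> sz x \<le> k} \<union> {x. x \<in> B \<and> sz x \<le> k}"
    by auto
  moreover have "finite {x. x \<in> A \<and> sz x \<le> k}" "finite {x. x \<in> B \<and> sz x \<le> k}"
    using finite_levels_subset[OF assms(1), of A] finite_levels_subset[OF assms(1), of B]
    by (auto simp: finite_levels_def)
  ultimately show "weight_gf sz (A \<union> B) f $ k = (weight_gf sz A f + weight_gf sz B f) $ k"
    using assms(2) by (simp add: weight_gf_nth) (intro sum.union_disjoint, auto)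
qed

lemma weight_gf_add:
  "weight_gf sz A (\<lambda>x. f x + g x) = weight_gf sz A f + weight_gf sz A g"
  by (rule fps_ext) (simp add: weight_gf_nth sum.distrib distrib_left)

lemma weight_gf_cmult:
  assumes "finite_levels sz A"
  shows "weight_gf sz A (\<lambda>x. c * f x) = c * weight_gf sz A f"
proof (rule fps_ext)
  fix k
  let ?T = "\<Sum>x | x \<in> A \<and> sz x \<le> k. fps_X ^ sz x * f x"
  have "(c * weight_gf sz A f) $ k = (c * ?T) $ k"
    unfolding fps_mult_nth
    by (intro sum.cong refl, subst weight_gf_nth_truncation[OF assms, of _ k]) auto
  also have "c * ?T = (\<Sum>x | x \<in> A \<and> sz x \<le> k. fps_X ^ sz x * (c * f x))"
    by (simp add: sum_distrib_left mult_ac)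
  finally show "weight_gf sz A (\<lambda>x. c * f x) $ k = (c * weight_gf sz A f) $ k"
    by (simp add: weight_gf_nth fps_sum_nth)
qed

lemma weight_gf_image:
  assumes "inj_on h A" "\<And>x. x \<in> A \<Longrightarrow> sz (h x) = sz' x + d"
  shows "weight_gf sz (h ` A) f = fps_X ^ d * weight_gf sz' A (\<lambda>x. f (h x))"
proof (rule fps_ext)
  fix k
  show "weight_gf sz (h ` A) f $ k = (fps_X ^ d * weight_gf sz' A (\<lambda>x. f (h x))) $ k"
  proof (cases "k < d")
    case True
    then have "{y. y \<in> h ` A \<and> sz y \<le> k} = {}" using assms(2) by auto
    then have "weight_gf sz (h ` A) f $ k = 0" unfolding weight_gf_nth by (simp only: sum.empty)
    then show ?thesis using True by (simp add: fps_X_power_mult_nth)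
  next
    case False
    have eq: "{y. y \<in> h ` A \<and> sz y \<le> k} = h ` {x. x \<in> A \<and> sz' x \<le> k - d}"
      using assms(2) False by auto
    have "weight_gf sz (h ` A) f $ k =
        (\<Sum>x | x \<in> A \<and> sz' x \<le> k - d. (fps_X ^ sz (h x) * f (h x)) $ k)"
      unfolding weight_gf_nth eq
      by (subst sum.reindex) (use assms(1) in \<open>auto intro: inj_on_subset\<close>)
    also have "\<dots> = (\<Sum>x | x \<in> A \<and> sz' x \<le> k - d. (fps_X ^ sz' x * f (h x)) $ (k - d))"
      by (rule sum.cong) (use assms(2) False in \<open>auto simp: fps_X_power_mult_nth add.commute\<close>)
    finally show ?thesis using False by (simp add: fps_X_power_mult_nth weight_gf_nth)
  qed
qed

text \<open>
  The product rule, in the dependent form that is needed here: the second component of a pair ranges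
  over a set that depends on the first.
\<close>

lemma weight_gf_Sigma:
  assumes "finite_levels sz A" "\<And>a. finite_levels sz' (B a)"
  shows "weight_gf (\<lambda>(a, b). sz a + sz' b) (Sigma A B) (\<lambda>(a, b). f a b) =
           weight_gf sz A (\<lambda>a. weight_gf sz' (B a) (f a))"
proof (rule fps_ext)
  fix k
  let ?B = "\<lambda>a. {b. b \<in> B a \<and> sz' b \<le> k - sz a}"
  have eq: "{p. p \<in> Sigma A B \<and> (case p of (a, b) \<Rightarrow> sz a + sz' b) \<le> k} =
      Sigma {a. a \<in> A \<and> sz a \<le> k} ?B"
    by auto
  have "weight_gf sz A (\<lambda>a. weight_gf sz' (B a) (f a)) $ k =
      (\<Sum>a | a \<in> A \<and> sz a \<le> k. \<Sum>b\<in>?B a. (fps_X ^ (sz a + sz' b) * f a b) $ k)"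
    unfolding weight_gf_nth
  proof (rule sum.cong[OF refl])
    fix a assume "a \<in> {a. a \<in> A \<and> sz a \<le> k}"
    then show "(fps_X ^ sz a * weight_gf sz' (B a) (f a)) $ k =
        (\<Sum>b\<in>?B a. (fps_X ^ (sz a + sz' b) * f a b) $ k)"
      by (auto simp: fps_X_power_mult_nth weight_gf_nth intro!: sum.cong)
  qed
  also have "\<dots> = (\<Sum>(a, b)\<in>Sigma {a. a \<in> A \<and> sz a \<le> k} ?B. (fps_X ^ (sz a + sz' b) * f a b) $ k)"
    by (rule sum.Sigma) (use assms in \<open>auto simp: finite_levels_def\<close>)
  finally show "weight_gf (\<lambda>(a, b). sz a + sz' b) (Sigma A B) (\<lambda>(a, b). f a b) $ k =
      weight_gf sz A (\<lambda>a. weight_gf sz' (B a) (f a)) $ k"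
    unfolding weight_gf_nth eq by (simp add: case_prod_unfold)
qed

lemma weight_gf_singleton: "weight_gf sz {x} f = fps_X ^ sz x * f x"
proof (rule fps_ext)
  fix k
  have "{y. y \<in> {x} \<and> sz y \<le> k} = (if sz x \<le> k then {x} else {})" by auto
  then show "weight_gf sz {x} f $ k = (fps_X ^ sz x * f x) $ k"
    unfolding weight_gf_nth by (simp only:) (simp add: fps_X_power_mult_nth)
qed

section \<open>The structure of avoiding words\<close>

fun descent_bottoms :: "nat list \<Rightarrow> nat set" where
  "descent_bottoms (x # y # w) = (if y < x then {y} else {}) \<union> descent_bottoms (y # w)"
| "descent_bottoms w = {}"

lemma contains_21_1_Nil [simp]: "\<not> contains_21_1 []"
  and contains_21_1_single [simp]: "\<not> contains_21_1 [x]"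
  by (auto simp: contains_21_1_def)

text \<open>
  An occurrence of the pattern either uses the first two letters as its descent or lies in the tail.
  With this recursion the statements about \<open>contains_21_1\<close> become inductions along the word.
\<close>

lemma contains_21_1_Cons_Cons [simp]:
  "contains_21_1 (x # y # w) \<longleftrightarrow> y < x \<and> y \<in> set w \<or> contains_21_1 (y # w)"
proof
  assume "contains_21_1 (x # y # w)"
  then obtain i j where ij: "i + 1 < j" "j < length (x # y # w)"
    "(x # y # w) ! i > (x # y # w) ! (i + 1)" "(x # y # w) ! (i + 1) = (x # y # w) ! j"
    unfolding contains_21_1_def by blast
  then obtain j' where j: "j = Suc (Suc j')"
    by (auto simp: less_iff_Suc_add)
  show "y < x \<and> y \<in> set w \<or> contains_21_1 (y # w)"
  proof (cases i)
    case 0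
    then show ?thesis using ij j by auto
  next
    case (Suc i')
    then have "i' + 1 < Suc j' \<and> Suc j' < length (y # w) \<and>
        (y # w) ! i' > (y # w) ! (i' + 1) \<and> (y # w) ! (i' + 1) = (y # w) ! Suc j'"
      using ij unfolding j by simp
    then have "contains_21_1 (y # w)"
      unfolding contains_21_1_def by blast
    then show ?thesis ..
  qed
next
  assume "y < x \<and> y \<in> set w \<or> contains_21_1 (y # w)"
  then show "contains_21_1 (x # y # w)"
  proof
    assume a: "y < x \<and> y \<in> set w"
    then obtain j where "j < length w" "w ! j = y" by (meson in_set_conv_nth)
    then show ?thesis
      unfolding contains_21_1_def using a by (intro exI[of _ 0] exI[of _ "Suc (Suc j)"]) auto
  next
    assume "contains_21_1 (y # w)"
    then obtain i j where "i + 1 < j" "j < length (y # w)"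
      "(y # w) ! i > (y # w) ! (i + 1)" "(y # w) ! (i + 1) = (y # w) ! j"
      unfolding contains_21_1_def by blast
    then show ?thesis
      unfolding contains_21_1_def by (intro exI[of _ "Suc i"] exI[of _ "Suc j"]) auto
  qed
qed

lemma contains_21_1_map_Suc [simp]: "contains_21_1 (map Suc w) = contains_21_1 w"
  by (induction w rule: descent_bottoms.induct) auto

lemma descent_bottoms_map_Suc [simp]: "descent_bottoms (map Suc w) = Suc ` descent_bottoms w"
  by (induction w rule: descent_bottoms.induct) auto

lemma descent_bottoms_subset: "descent_bottoms w \<subseteq> set w"
  by (induction w rule: descent_bottoms.induct) auto

lemma contains_21_1_Cons_1: "\<forall>x\<in>set w. 1 \<le> x \<Longrightarrow> contains_21_1 (1 # w) = contains_21_1 w"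
  by (cases w) auto

lemma descent_bottoms_Cons_1: "\<forall>x\<in>set w. 1 \<le> x \<Longrightarrow> descent_bottoms (1 # w) = descent_bottoms w"
  by (cases w) auto

text \<open>
  A \<open>1\<close> after larger letters is a descent bottom, so no other \<open>1\<close> may follow. Otherwise the two sides
  interact only through descent bottoms of \<open>p\<close> repeated in \<open>r\<close>.
\<close>

lemma contains_21_1_append_1:
  assumes "p \<noteq> []" "\<forall>x\<in>set p. 1 < x"
  shows "contains_21_1 (p @ 1 # r) \<longleftrightarrow>
    contains_21_1 p \<or> descent_bottoms p \<inter> set r \<noteq> {} \<or> 1 \<in> set r \<or> contains_21_1 (1 # r)"
  using assms by (induction p rule: descent_bottoms.induct) auto

lemma descent_bottoms_append_1:
  assumes "p \<noteq> []" "\<forall>x\<in>set p. 1 < x"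
  shows "descent_bottoms (p @ 1 # r) = descent_bottoms p \<union> {1} \<union> descent_bottoms (1 # r)"
  using assms by (induction p rule: descent_bottoms.induct) auto

text \<open>
  A constant of its own, because the simplifier normalises a relation written out under
  \<open>successively\<close>, after which equal conditions no longer match syntactically.
\<close>

definition rises_by_at_most_one :: "nat list \<Rightarrow> bool" where
  "rises_by_at_most_one = successively (\<lambda>x y. y \<le> Suc x)"

lemma rises_Nil [simp]: "rises_by_at_most_one []"
  and rises_single [simp]: "rises_by_at_most_one [x]"
  and rises_Cons: "w \<noteq> [] \<Longrightarrow> rises_by_at_most_one (x # w) \<longleftrightarrow> hd w \<le> Suc x \<and> rises_by_at_most_one w"
  and rises_append: "p \<noteq> [] \<Longrightarrow> q \<noteq> [] \<Longrightarrow> rises_by_at_most_one (p @ q) \<longleftrightarrow>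
    rises_by_at_most_one p \<and> rises_by_at_most_one q \<and> hd q \<le> Suc (last p)"
  and rises_map_Suc [simp]: "rises_by_at_most_one (map Suc w) = rises_by_at_most_one w"
  by (auto simp: rises_by_at_most_one_def successively_Cons successively_append_iff successively_map)

definition avoiders :: "nat list set" where
  "avoiders = {w. w \<noteq> [] \<and> hd w = 1 \<and> (\<forall>x\<in>set w. 1 \<le> x) \<and>
     rises_by_at_most_one w \<and> \<not> contains_21_1 w}"

lemma avoiding_words_eq: "avoiding_words n = {w \<in> avoiders. length w = n}"
  unfolding avoiding_words_def catalan_words_def avoiders_def
  by (auto simp: rises_by_at_most_one_def successively_conv_nth hd_conv_nth)

lemma avoidersD:
  assumes "w \<in> avoiders"
  shows "w \<noteq> []" "hd w = 1" "\<And>x. x \<in> set w \<Longrightarrow> 1 \<le> x"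
    "rises_by_at_most_one w" "\<not> contains_21_1 w"
  using assms by (auto simp: avoiders_def)

lemma obtain_map_Suc:
  assumes "\<forall>x\<in>set w. 1 < x"
  obtains u where "w = map Suc u"
proof
  show "w = map Suc (map (\<lambda>x. x - 1) w)" using assms by (auto intro!: map_idI[symmetric])
qed

text \<open>
  To climb from \<open>1\<close> to \<open>y\<close> in steps of at most one, a word has to visit every letter in between.
\<close>

lemma initial_segment_if_small_steps:
  assumes "w \<noteq> []" "hd w = 1" "rises_by_at_most_one w" "y \<in> set w"
  shows "{1..y} \<subseteq> set w"
  using assms
proof (induction w arbitrary: y rule: rev_nonempty_induct)
  case (single x)
  then show ?case by simp
next
  case (snoc x xs)
  have h: "hd xs = 1" "rises_by_at_most_one xs" "x \<le> Suc (last xs)"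
    using snoc.prems snoc.hyps by (auto simp: rises_append)
  have "{1..last xs} \<subseteq> set xs" using snoc.IH h snoc.hyps by simp
  moreover have "{1..x} \<subseteq> insert x {1..last xs}" using h(3) by auto
  ultimately have "{1..x} \<subseteq> set (xs @ [x])" by auto
  moreover have "{1..y} \<subseteq> set xs" if "y \<in> set xs"
    using snoc.IH[OF h(1,2) that] .
  ultimately show ?case using snoc.prems(3) by auto
qed

lemma avoiders_set_eq:
  assumes "w \<in> avoiders"
  shows "set w = {1..Max (set w)}"
proof
  show "set w \<subseteq> {1..Max (set w)}"
    using avoidersD[OF assms] by (auto intro: Max_ge)
  have "Max (set w) \<in> set w" using avoidersD(1)[OF assms] by simp
  then show "{1..Max (set w)} \<subseteq> set w"
    using initial_segment_if_small_steps avoidersD[OF assms] by blast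
qed

lemma Max_le_length: "w \<in> avoiders \<Longrightarrow> Max (set w) \<le> length w"
  using avoiders_set_eq[of w] card_length[of w] by (metis card_atLeastAtMost diff_Suc_1)

lemma Max_ge_1: "w \<in> avoiders \<Longrightarrow> 1 \<le> Max (set w)"
  using avoidersD[of w] by (metis List.finite_set Max_in set_empty)

text \<open>
  The avoiding words whose descent bottoms all exceed \<open>m\<close>: these are the words that may be combined
  with a later part with maximum \<open>m\<close>.
\<close>

definition avoiders_above :: "nat \<Rightarrow> nat list set" where
  "avoiders_above m = {u \<in> avoiders. descent_bottoms u \<inter> {1..m} = {}}"

lemma finite_levels_avoiders: "finite_levels length avoiders"
  unfolding finite_levels_def
proof
  fix N
  have "{w \<in> avoiders. length w \<le> N} \<subseteq> {w. set w \<subseteq> {..N} \<and> length w \<le> N}"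
    using Max_le_length by (fastforce dest: order_trans[OF Max_ge[OF finite_set]])
  then show "finite {w \<in> avoiders. length w \<le> N}"
    by (rule finite_subset) (rule finite_lists_length_le, simp)
qed

lemma singleton_mem: "[1] \<in> avoiders" by (simp add: avoiders_def)

lemma Cons_1_mem: "w \<in> avoiders \<Longrightarrow> 1 # w \<in> avoiders"
  using contains_21_1_Cons_1[of w] by (auto simp: avoiders_def rises_Cons)

lemma lift_mem_iff:
  assumes "u \<noteq> []" "\<forall>x\<in>set u. 1 \<le> x"
  shows "1 # map Suc u \<in> avoiders \<longleftrightarrow> u \<in> avoiders"
proof -
  have "contains_21_1 (1 # map Suc u) = contains_21_1 u"
    by (subst contains_21_1_Cons_1) auto
  moreover have "hd u \<le> 1 \<longleftrightarrow> hd u = 1"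
    using assms(1,2) by (metis hd_in_set le_antisym order_refl)
  ultimately show ?thesis
    using assms by (auto simp: avoiders_def rises_Cons hd_map)
qed

lemma lift_append_mem_iff:
  assumes "u \<noteq> []" "\<forall>x\<in>set u. 1 \<le> x" "\<forall>x\<in>set r. 1 \<le> x"
  shows "1 # map Suc u @ 1 # r \<in> avoiders \<longleftrightarrow>
    u \<in> avoiders \<and> 1 \<notin> set r \<and> 1 # r \<in> avoiders \<and> Suc ` descent_bottoms u \<inter> set r = {}"
proof -
  have "contains_21_1 (1 # map Suc u @ 1 # r) = contains_21_1 (map Suc u @ 1 # r)"
    by (subst contains_21_1_Cons_1) (use assms in auto)
  also have "\<dots> \<longleftrightarrow> contains_21_1 u \<or> Suc ` descent_bottoms u \<inter> set r \<noteq> {} \<or> 1 \<in> set r \<or>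
      contains_21_1 (1 # r)"
    by (subst contains_21_1_append_1) (use assms in auto)
  finally have "contains_21_1 (1 # map Suc u @ 1 # r) \<longleftrightarrow> \<dots>" .
  moreover have "hd u \<le> 1 \<longleftrightarrow> hd u = 1"
    using assms(1,2) by (metis hd_in_set le_antisym order_refl)
  ultimately show ?thesis
    using assms by (auto simp: avoiders_def rises_Cons rises_append hd_map)
qed

definition lift :: "nat list \<Rightarrow> nat list" where "lift u = 1 # map Suc u"

lemma lift_append_lift_mem_iff:
  assumes "u \<in> avoiders" "u' \<in> avoiders"
  shows "lift u @ lift u' \<in> avoiders \<longleftrightarrow> descent_bottoms u \<inter> set u' = {}"
proof -
  have "1 # map Suc u' \<in> avoiders" using lift_mem_iff avoidersD[OF assms(2)] assms(2) by blast
  moreover have "Suc ` descent_bottoms u \<inter> Suc ` set u' = {} \<longleftrightarrow> descent_bottoms u \<inter> set u' = {}"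
    by auto
  moreover have "1 \<notin> set (map Suc u')" using avoidersD[OF assms(2)] by auto
  moreover have "\<forall>x\<in>set (map Suc u'). 1 \<le> x" by auto
  ultimately show ?thesis
    using lift_append_mem_iff[of u "map Suc u'"] avoidersD[OF assms(1)] assms(1) by (simp add: lift_def)
qed

text \<open>
  The letters of \<open>u'\<close> form an initial segment, so compatibility with \<open>u'\<close> depends on its maximum only.
\<close>

lemma avoiders_above_Max: "u' \<in> avoiders \<Longrightarrow> u \<in> avoiders_above (Max (set u')) \<longleftrightarrow> u \<in> avoiders \<and> descent_bottoms u \<inter> set u' = {}"
  using avoiders_set_eq[of u'] by (simp add: avoiders_above_def)

text \<open>
  The five parts are: the word \<open>1\<close>, words starting with \<open>11\<close>, words starting with \<open>12\<close> without
  another \<open>1\<close>, and words starting with \<open>12\<close> with exactly one further \<open>1\<close>, which is or is not the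
  last letter. There is no further case because that second \<open>1\<close> is a descent bottom.
\<close>

lemma avoiders_decomposition:
  "avoiders = {[1]} \<union> Cons 1 ` avoiders \<union> lift ` avoiders \<union> (\<lambda>u. lift u @ [1]) ` avoiders \<union>
     (\<lambda>(u', u). lift u @ lift u') ` (SIGMA u':avoiders. avoiders_above (Max (set u')))"
  (is "_ = ?A \<union> ?B \<union> ?C \<union> ?D \<union> ?E")
proof (intro equalityI subsetI)
  fix w assume w: "w \<in> avoiders"
  then obtain v where v: "w = 1 # v" using avoidersD[of w] by (cases w) auto
  have v1: "\<forall>x\<in>set v. 1 \<le> x" using avoidersD(3)[OF w] v by auto
  consider "v = []" | "v \<noteq> []" "hd v = 1" | "v \<noteq> []" "hd v \<noteq> 1" by blast
  then show "w \<in> ?A \<union> ?B \<union> ?C \<union> ?D \<union> ?E"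
  proof cases
    case 1
    then show ?thesis using v by simp
  next
    case 2
    then have "v \<in> avoiders"
      using w v v1 contains_21_1_Cons_1[of v] by (auto simp: avoiders_def rises_Cons)
    then show ?thesis using v by blast
  next
    case 3
    \<comment> \<open>Split the rest of the word at its first \<open>1\<close>.\<close>
    define p where "p = takeWhile (\<lambda>x. x \<noteq> 1) v"
    define q where "q = dropWhile (\<lambda>x. x \<noteq> 1) v"
    have pq: "v = p @ q" by (simp add: p_def q_def)
    have "p \<noteq> []" using 3 by (cases v) (auto simp: p_def)
    have "\<forall>x\<in>set p. 1 < x"
      using v1 unfolding p_def by (metis le_neq_implies_less set_takeWhileD)
    then obtain u where u: "p = map Suc u" by (rule obtain_map_Suc)
    have u1: "u \<noteq> []" "\<forall>x\<in>set u. 1 \<le> x"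
      using \<open>p \<noteq> []\<close> \<open>\<forall>x\<in>set p. 1 < x\<close> u by auto
    show ?thesis
    proof (cases q)
      case Nil
      then have "w = lift u" using v pq u by (simp add: lift_def)
      moreover from this have "u \<in> avoiders" using lift_mem_iff[OF u1] w by (simp add: lift_def)
      ultimately show ?thesis by blast
    next
      case (Cons y r)
      then have "y = 1" unfolding q_def by (metis (mono_tags, lifting) dropWhile_eq_Cons_conv)
      then have w_eq: "w = 1 # map Suc u @ 1 # r" using v pq u Cons by simp
      have r1: "\<forall>x\<in>set r. 1 \<le> x" using v1 pq Cons by auto
      have *: "u \<in> avoiders" "1 \<notin> set r" "1 # r \<in> avoiders" "Suc ` descent_bottoms u \<inter> set r = {}"
        using w lift_append_mem_iff[OF u1 r1] unfolding w_eq by blast+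
      have "\<forall>x\<in>set r. 1 < x" using *(2) r1 by (metis le_neq_implies_less)
      then obtain u' where u': "r = map Suc u'" by (rule obtain_map_Suc)
      show ?thesis
      proof (cases "u' = []")
        case True
        then have "w = lift u @ [1]" using w_eq u' by (simp add: lift_def)
        then show ?thesis using *(1) by blast
      next
        case False
        have "\<forall>x\<in>set u'. 1 \<le> x" using \<open>\<forall>x\<in>set r. 1 < x\<close> u' by auto
        then have "u' \<in> avoiders" using *(3) u' lift_mem_iff[OF False] by simp
        moreover have "descent_bottoms u \<inter> set u' = {}" using *(4) u' by auto
        ultimately have "(u', u) \<in> (SIGMA u':avoiders. avoiders_above (Max (set u')))"
          using *(1) avoiders_above_Max by auto
        moreover have "w = lift u @ lift u'" using w_eq u' by (simp add: lift_def)
        ultimately show ?thesis by (auto intro!: image_eqI[of _ _ "(u', u)"])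
      qed
    qed
  qed
next
  fix w assume "w \<in> ?A \<union> ?B \<union> ?C \<union> ?D \<union> ?E"
  moreover have "lift u \<in> avoiders" "lift u @ [1] \<in> avoiders" if "u \<in> avoiders" for u
    using lift_mem_iff[of u] lift_append_mem_iff[of u "[]"] avoidersD[OF that] that singleton_mem
    by (simp_all add: lift_def)
  moreover have "lift u @ lift u' \<in> avoiders" if "u' \<in> avoiders" "u \<in> avoiders_above (Max (set u'))" for u u'
    using that avoiders_above_Max lift_append_lift_mem_iff by blast
  ultimately show "w \<in> avoiders" using singleton_mem Cons_1_mem by auto
qed

lemma descent_bottoms_lift [simp]: "descent_bottoms (lift u) = Suc ` descent_bottoms u"
  unfolding lift_def by (subst descent_bottoms_Cons_1) auto

lemma one_in_descent_bottoms:
  assumes "u \<in> avoiders"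
  shows "1 \<in> descent_bottoms (lift u @ 1 # r)"
proof -
  have "\<forall>x\<in>set (map Suc u). 1 < x" "map Suc u \<noteq> []" using avoidersD[OF assms] by force+
  then have "1 \<in> descent_bottoms (map Suc u @ 1 # r)"
    using descent_bottoms_append_1 by blast
  then show ?thesis
    unfolding lift_def using avoidersD(1)[OF assms] by (cases u) auto
qed

lemma avoiders_above_0: "avoiders_above 0 = avoiders"
  by (simp add: avoiders_above_def)

text \<open>
  Of the five parts of \<open>avoiders_decomposition\<close> the last two disappear, because there \<open>1\<close> is itself
  a descent bottom. Raising all letters by one turns the bound \<open>m\<close> into \<open>m + 1\<close>.
\<close>

lemma avoiders_above_decomposition:
  "avoiders_above (Suc m) = {[1]} \<union> Cons 1 ` avoiders_above (Suc m) \<union> lift ` avoiders_above m"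
proof (intro equalityI subsetI)
  have shift: "lift u \<in> avoiders_above (Suc m) \<longleftrightarrow> u \<in> avoiders_above m" if "u \<in> avoiders" for u
  proof -
    have "0 \<notin> descent_bottoms u"
      using descent_bottoms_subset[of u] avoidersD(3)[OF that, of 0] by auto
    then have "Suc x \<in> {1..Suc m} \<longleftrightarrow> x \<in> {1..m}" if "x \<in> descent_bottoms u" for x
      using that by (cases x) auto
    then have "(\<forall>x\<in>Suc ` descent_bottoms u. x \<notin> {1..Suc m}) \<longleftrightarrow>
        (\<forall>x\<in>descent_bottoms u. x \<notin> {1..m})"
      by (simp only: ball_simps) blast
    then have "Suc ` descent_bottoms u \<inter> {1..Suc m} = {} \<longleftrightarrow> descent_bottoms u \<inter> {1..m} = {}"
      by (simp only: disjoint_iff Ball_def)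
    moreover have "lift u \<in> avoiders"
      by (rule subsetD[OF equalityD2[OF avoiders_decomposition]]) (use that in blast)
    ultimately show ?thesis using that by (simp add: avoiders_above_def)
  qed
  have cons: "1 # u \<in> avoiders_above (Suc m) \<longleftrightarrow> u \<in> avoiders_above (Suc m)" if "u \<in> avoiders" for u
    using that avoidersD[OF that] descent_bottoms_Cons_1[of u] Cons_1_mem[OF that] by (simp add: avoiders_above_def)
  {
    fix w assume w: "w \<in> avoiders_above (Suc m)"
    then have "w \<in> avoiders" and "1 \<notin> descent_bottoms w" by (auto simp: avoiders_above_def)
    then have "w \<in> {[1]} \<union> Cons 1 ` avoiders \<union> lift ` avoiders"
      using avoiders_decomposition one_in_descent_bottoms
      by (subst (asm) avoiders_decomposition) (auto simp: lift_def[of "_ :: nat list"] avoiders_above_def)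
    then show "w \<in> {[1]} \<union> Cons 1 ` avoiders_above (Suc m) \<union> lift ` avoiders_above m"
      using w shift cons by auto
  next
    fix w assume "w \<in> {[1]} \<union> Cons 1 ` avoiders_above (Suc m) \<union> lift ` avoiders_above m"
    moreover have "avoiders_above k \<subseteq> avoiders" for k by (auto simp: avoiders_above_def)
    moreover have "[1] \<in> avoiders_above (Suc m)" using singleton_mem by (simp add: avoiders_above_def)
    ultimately show "w \<in> avoiders_above (Suc m)" using shift cons by auto
  }
qed

section \<open>The functional equation\<close>

lemma finite_avoiding_words: "finite (avoiding_words n)"
  using finite_levels_avoiders unfolding finite_levels_def avoiding_words_eq
  by (auto intro: finite_subset[of _ "{w \<in> avoiders. length w \<le> n}"])

text \<open>
  The definition of \<open>R_gf\<close> groups words by length and maximum; summing over the words themselves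
  makes set decompositions applicable.
\<close>

lemma R_gf_eq_weight_gf: "R_gf v = weight_gf length avoiders (\<lambda>w. v ^ (Max (set w) - 1))"
proof (rule fps_ext)
  fix k
  let ?S = "\<lambda>n m. {w \<in> avoiding_words (Suc n). Max (set w) = m}"
  let ?wt = "\<lambda>w. fps_X ^ length w * v ^ (Max (set w) - 1)"
  let ?f = "\<lambda>n. \<Sum>m=1..Suc n. of_nat (avoiding_max_count (Suc n) m) * fps_X ^ Suc n * v ^ (m - 1)"
  have level: "?f n = (\<Sum>w\<in>avoiding_words (Suc n). ?wt w)" for n
  proof -
    have "?f n = (\<Sum>m=1..Suc n. \<Sum>w\<in>?S n m. ?wt w)"
    proof (rule sum.cong[OF refl])
      fix m assume "m \<in> {1..Suc n}"
      have "(\<Sum>w\<in>?S n m. ?wt w) = (\<Sum>w\<in>?S n m. fps_X ^ Suc n * v ^ (m - 1))"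
        by (rule sum.cong) (auto simp: avoiding_words_eq)
      then show "of_nat (avoiding_max_count (Suc n) m) * fps_X ^ Suc n * v ^ (m - 1) =
          (\<Sum>w\<in>?S n m. ?wt w)"
        by (simp add: avoiding_max_count_def mult.assoc)
    qed
    also have "\<dots> = (\<Sum>w\<in>avoiding_words (Suc n). ?wt w)"
      by (rule sum.group) (use finite_avoiding_words Max_ge_1 Max_le_length in \<open>force simp: avoiding_words_eq\<close>)+
    finally show ?thesis .
  qed
  have "(\<lambda>N. (\<Sum>n<N. ?f n)) \<longlonglongrightarrow> R_gf v"
    using R_gf_sums unfolding sums_def .
  then have "\<forall>\<^sub>F N in sequentially. (\<Sum>n<N. ?f n) $ k = R_gf v $ k"
    unfolding tendsto_fps_iff by blast
  then have "\<forall>\<^sub>F N in sequentially. k \<le> N \<and> (\<Sum>n<N. ?f n) $ k = R_gf v $ k"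
    by (rule eventually_conj[OF eventually_ge_at_top])
  then obtain N where N: "k \<le> N" "(\<Sum>n<N. ?f n) $ k = R_gf v $ k"
    using eventually_happens'[OF sequentially_bot] by blast
  have words: "{w. w \<in> avoiders \<and> length w \<le> N} = (\<Union>n<N. avoiding_words (Suc n))"
  proof (intro equalityI subsetI)
    fix w assume w: "w \<in> {w. w \<in> avoiders \<and> length w \<le> N}"
    then obtain n where "length w = Suc n" using avoidersD(1) by (cases w) auto
    then show "w \<in> (\<Union>n<N. avoiding_words (Suc n))" using w by (auto simp: avoiding_words_eq)
  qed (auto simp: avoiding_words_eq)
  have "weight_gf length avoiders (\<lambda>w. v ^ (Max (set w) - 1)) $ k = (\<Sum>w | w \<in> avoiders \<and> length w \<le> N. ?wt w) $ k"
    by (rule weight_gf_nth_truncation[OF finite_levels_avoiders N(1)])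
  also have "(\<Sum>w | w \<in> avoiders \<and> length w \<le> N. ?wt w) = (\<Sum>n<N. ?f n)"
    unfolding words level by (rule sum.UNION_disjoint) (use finite_avoiding_words in \<open>auto simp: avoiding_words_eq\<close>)
  finally show "R_gf v $ k = weight_gf length avoiders (\<lambda>w. v ^ (Max (set w) - 1)) $ k"
    using N(2) by simp
qed

lemma avoiding_count_eq_sum: "avoiding_count n = (\<Sum>m=1..n. avoiding_max_count n m)"
proof -
  have "(\<Sum>m=1..n. \<Sum>w | w \<in> avoiding_words n \<and> Max (set w) = m. 1) =
      (\<Sum>w\<in>avoiding_words n. 1 :: nat)"
    by (rule sum.group) (use finite_avoiding_words Max_ge_1 Max_le_length in \<open>force simp: avoiding_words_eq\<close>)+
  then show ?thesis
    by (simp add: avoiding_count_def avoiding_max_count_def)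
qed

text \<open>
  If \<open>Max (set u') = m\<close>, then the maximum of \<open>lift u @ lift u'\<close> is one more than the larger of the
  maxima of \<open>u\<close> and \<open>u'\<close>, so the weight of that word is \<open>v\<close> times the one used here.
\<close>

definition avoiders_above_gf :: "'a::comm_ring_1 fps \<Rightarrow> nat \<Rightarrow> 'a fps" where
  "avoiders_above_gf v m = weight_gf length (avoiders_above m) (\<lambda>u. v ^ (max (Max (set u)) m - 1))"

lemma length_lift [simp]: "length (lift u) = Suc (length u)" by (simp add: lift_def)

lemma Max_lift: "u \<noteq> [] \<Longrightarrow> Max (set (lift u)) = Suc (Max (set u))"
  by (simp add: lift_def flip: mono_Max_commute[of Suc, OF monoI])

lemma finite_levels_avoiders_above: "finite_levels length (avoiders_above m)"
  by (rule finite_levels_subset[OF finite_levels_avoiders]) (auto simp: avoiders_above_def)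

lemma inj_lift: "inj lift" by (auto simp: lift_def inj_def inj_map_eq_map)

lemma lift_eq_iff [simp]: "lift u = lift u' \<longleftrightarrow> u = u'"
  using inj_lift by (auto dest: injD)

lemma avoiders_letter_neq_0: "u \<in> avoiders \<Longrightarrow> 0 \<notin> set u"
  using avoidersD(3)[of u 0] by auto

lemma lift_append_neq_Cons_1: "u \<in> avoiders \<Longrightarrow> w \<in> avoiders \<Longrightarrow> lift u @ q \<noteq> 1 # w"
  by (cases u) (auto simp: lift_def avoiders_def)

lemma lift_append_notin: "u \<in> avoiders \<Longrightarrow> lift u @ q \<notin> {[1]} \<union> Cons 1 ` avoiders"
  using lift_append_neq_Cons_1 avoidersD(1)[of u] by (auto simp: lift_def)

lemma lift_neq_lift_append_1: "u \<in> avoiders \<Longrightarrow> lift u \<noteq> lift u' @ 1 # r"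
proof
  assume u: "u \<in> avoiders" and "lift u = lift u' @ 1 # r"
  then have "map Suc u = map Suc u' @ 1 # r" by (simp add: lift_def)
  then have "1 \<in> set (map Suc u)" by (metis in_set_conv_decomp)
  then show False using avoiders_letter_neq_0[OF u] by auto
qed

lemma lift_append_single_neq_lift_append_lift:
  assumes "u' \<in> avoiders"
  shows "lift w @ [1] \<noteq> lift u @ lift u'"
proof
  assume "lift w @ [1] = lift u @ lift u'"
  then have "last (lift w @ [1]) = last (lift u @ lift u')" by simp
  then have "last (map Suc u') = 1" using avoidersD(1)[OF assms] by (simp add: lift_def split: if_splits)
  then show False using avoidersD(1)[OF assms] avoiders_letter_neq_0[OF assms] last_in_set[of u']
    by (auto simp: last_map)
qed

lemma lift_append_lift_eq_iff:
  assumes "u \<in> avoiders" "u' \<in> avoiders"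
  shows "lift u @ lift u' = lift x @ lift x' \<longleftrightarrow> u = x \<and> u' = x'"
proof
  assume "lift u @ lift u' = lift x @ lift x'"
  then have "map Suc u @ 1 # map Suc u' = map Suc x @ 1 # map Suc x'" by (simp add: lift_def)
  moreover have "1 \<notin> set (map Suc u)" "1 \<notin> set (map Suc u')"
    using avoiders_letter_neq_0 assms by auto
  ultimately have "map Suc u = map Suc x \<and> map Suc u' = map Suc x'"
    by (subst (asm) append_Cons_eq_iff) auto
  then show "u = x \<and> u' = x'" by (simp add: inj_map_eq_map)
qed simp

lemma avoiders_above_subset: "avoiders_above m \<subseteq> avoiders"
  by (auto simp: avoiders_above_def)

text \<open>
  The three summands are the three parts of \<open>avoiders_above_decomposition\<close>.
\<close>

lemma avoiders_above_gf_Suc_peel: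
  "avoiders_above_gf v (Suc m) = fps_X * v ^ m + fps_X * avoiders_above_gf v (Suc m) + fps_X * v * avoiders_above_gf v m"
proof -
  let ?w = "\<lambda>m u. v ^ (max (Max (set u)) m - 1)"
  let ?g = "\<lambda>A. weight_gf length A (?w (Suc m))"
  let ?A = "{[1]} :: nat list set" and ?B = "Cons 1 ` avoiders_above (Suc m)" and ?C = "lift ` avoiders_above m"
  note levels = finite_levels_subset[OF finite_levels_avoiders_above[of "Suc m"]]
  have sub: "?A \<union> ?B \<union> ?C \<subseteq> avoiders_above (Suc m)" by (rule equalityD2[OF avoiders_above_decomposition])
  have disj: "(?A \<union> ?B) \<inter> ?C = {}" "?A \<inter> ?B = {}"
    using lift_append_neq_Cons_1[where q = "[]"] avoidersD(1) avoiders_above_subset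
    by (auto simp: lift_def subset_iff) blast+
  have "avoiders_above_gf v (Suc m) = ?g (?A \<union> ?B \<union> ?C)"
    unfolding avoiders_above_gf_def by (rule arg_cong[OF avoiders_above_decomposition])
  also have "\<dots> = ?g ?A + ?g ?B + ?g ?C"
    by (subst weight_gf_Un levels disj, (use sub disj in \<open>auto intro: levels\<close>)[2])+ (rule refl)
  also have "?g ?A = fps_X * v ^ m"
    by (simp add: weight_gf_singleton)
  also have "?g ?B = fps_X ^ 1 * weight_gf length (avoiders_above (Suc m)) (\<lambda>u. ?w (Suc m) (1 # u))"
    by (rule weight_gf_image) auto
  also have "weight_gf length (avoiders_above (Suc m)) (\<lambda>u. ?w (Suc m) (1 # u)) = avoiders_above_gf v (Suc m)"
    unfolding avoiders_above_gf_def
  proof (rule weight_gf_cong)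
    fix u assume "u \<in> avoiders_above (Suc m)"
    then have "u \<in> avoiders" using avoiders_above_subset by blast
    then show "?w (Suc m) (1 # u) = ?w (Suc m) u"
      using avoidersD(1) Max_ge_1 by (simp add: max_def)
  qed
  also have "?g ?C = fps_X ^ 1 * weight_gf length (avoiders_above m) (\<lambda>u. ?w (Suc m) (lift u))"
    by (rule weight_gf_image) (auto intro: inj_on_subset[OF inj_lift])
  also have "weight_gf length (avoiders_above m) (\<lambda>u. ?w (Suc m) (lift u)) =
      weight_gf length (avoiders_above m) (\<lambda>u. v * ?w m u)"
  proof (rule weight_gf_cong)
    fix u assume "u \<in> avoiders_above m"
    then have u: "u \<in> avoiders" using avoiders_above_subset by blast
    have "max (Suc (Max (set u))) (Suc m) - 1 = Suc (max (Max (set u)) m - 1)"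
      using Max_ge_1[OF u] by (simp add: max_def)
    then show "?w (Suc m) (lift u) = v * ?w m u"
      unfolding Max_lift[OF avoidersD(1)[OF u]] by (simp only: power_Suc)
  qed
  also have "\<dots> = v * avoiders_above_gf v m"
    unfolding avoiders_above_gf_def by (rule weight_gf_cmult[OF finite_levels_avoiders_above])
  finally show ?thesis by (simp add: mult.assoc)
qed

text \<open>
  The five summands are the five parts of \<open>avoiders_decomposition\<close>. In the last one the inner series
  sums over the left part \<open>u\<close> once the right part is chosen.
\<close>

lemma R_peel:
  "R_gf v = fps_X + fps_X * R_gf v + fps_X * v * R_gf v + fps_X ^ 2 * v * R_gf v +
     fps_X ^ 2 * v * weight_gf length avoiders (\<lambda>u. avoiders_above_gf v (Max (set u)))"
proof -
  let ?w = "\<lambda>u. v ^ (Max (set u) - 1)"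
  let ?g = "\<lambda>A. weight_gf length A ?w"
  let ?S = "SIGMA u':avoiders. avoiders_above (Max (set u'))"
  let ?A = "{[1]} :: nat list set" and ?B = "Cons 1 ` avoiders" and ?C = "lift ` avoiders"
  let ?D = "(\<lambda>u. lift u @ [1]) ` avoiders" and ?E = "(\<lambda>(u', u). lift u @ lift u') ` ?S"
  note levels = finite_levels_subset[OF finite_levels_avoiders]
  have lift_weight: "?w (lift u) = v * ?w u" "?w (lift u @ [1]) = v * ?w u" if "u \<in> avoiders" for u
  proof -
    have "Max (set (lift u @ [1])) = Max (set (lift u))"
      by (rule arg_cong[where f = Max]) (auto simp: lift_def)
    moreover have "Suc (Max (set u)) - 1 = Suc (Max (set u) - 1)" using Max_ge_1[OF that] by simp
    ultimately show "?w (lift u) = v * ?w u" "?w (lift u @ [1]) = v * ?w u"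
      using Max_lift avoidersD(1)[OF that] by (metis power_Suc)+
  qed
  have sub: "?A \<union> ?B \<union> ?C \<union> ?D \<union> ?E \<subseteq> avoiders" by (rule equalityD2[OF avoiders_decomposition])
  have AB: "?A \<inter> ?B = {}" using avoidersD(1) by auto
  have ABC: "(?A \<union> ?B) \<inter> ?C = {}"
    unfolding disjoint_iff using lift_append_notin[where q = "[]"] by (metis append_Nil2 imageE)
  have ABCD: "(?A \<union> ?B \<union> ?C) \<inter> ?D = {}"
  proof (intro equals0I)
    fix w assume "w \<in> (?A \<union> ?B \<union> ?C) \<inter> ?D"
    then obtain u where u: "u \<in> avoiders" "w = lift u @ [1]" and mem: "w \<in> (?A \<union> ?B) \<union> ?C"
      by blast
    then have "w \<in> ?C" using lift_append_notin by blast
    then show False using lift_neq_lift_append_1[where r = "[]"] u(2) by (metis imageE)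
  qed
  have ABCDE: "(?A \<union> ?B \<union> ?C \<union> ?D) \<inter> ?E = {}"
  proof (intro equals0I)
    fix w assume "w \<in> (?A \<union> ?B \<union> ?C \<union> ?D) \<inter> ?E"
    then have mem: "w \<in> (?A \<union> ?B) \<union> ?C \<union> ?D" and "w \<in> ?E" by (rule IntD1, rule IntD2)
    then obtain p where "p \<in> ?S" and wp: "w = (\<lambda>(u', u). lift u @ lift u') p" by (elim imageE)
    moreover obtain u' u where "p = (u', u)" by (cases p)
    ultimately have u: "u \<in> avoiders" "u' \<in> avoiders" and w: "w = lift u @ lift u'"
      using avoiders_above_subset by auto
    have n1: "w \<notin> ?A \<union> ?B"
      unfolding w by (rule lift_append_notin[OF u(1)])
    have n2: "w \<notin> ?C"
      unfolding w using lift_neq_lift_append_1 lift_def[of u'] by (metis imageE)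
    have n3: "w \<notin> ?D"
    proof
      assume "w \<in> ?D"
      then obtain x where "w = lift x @ [1]" by (elim imageE)
      then show False using w lift_append_single_neq_lift_append_lift[OF u(2), of x u] by metis
    qed
    from mem show False
    proof (rule UnE)
      assume "w \<in> (?A \<union> ?B) \<union> ?C"
      then show False by (rule UnE) (erule notE[OF n1], erule notE[OF n2])
    qed (rule notE[OF n3])
  qed
  have "R_gf v = ?g (?A \<union> ?B \<union> ?C \<union> ?D \<union> ?E)"
    unfolding R_gf_eq_weight_gf by (rule arg_cong[OF avoiders_decomposition])
  also have "\<dots> = ?g (?A \<union> ?B \<union> ?C \<union> ?D) + ?g ?E"
    by (rule weight_gf_Un[OF levels ABCDE]) (use sub in \<open>simp only: Un_subset_iff\<close>)
  also have "?g (?A \<union> ?B \<union> ?C \<union> ?D) = ?g (?A \<union> ?B \<union> ?C) + ?g ?D"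
    by (rule weight_gf_Un[OF levels ABCD]) (use sub in \<open>simp only: Un_subset_iff\<close>)
  also have "?g (?A \<union> ?B \<union> ?C) = ?g (?A \<union> ?B) + ?g ?C"
    by (rule weight_gf_Un[OF levels ABC]) (use sub in \<open>simp only: Un_subset_iff\<close>)
  also have "?g (?A \<union> ?B) = ?g ?A + ?g ?B"
    by (rule weight_gf_Un[OF levels AB]) (use sub in \<open>simp only: Un_subset_iff\<close>)
  also have "?g ?A = fps_X"
    by (simp add: weight_gf_singleton)
  also have "?g ?B = fps_X ^ 1 * weight_gf length avoiders (\<lambda>u. ?w (1 # u))"
    by (rule weight_gf_image) auto
  also have "weight_gf length avoiders (\<lambda>u. ?w (1 # u)) = R_gf v"
    unfolding R_gf_eq_weight_gf
    by (rule weight_gf_cong) (use avoidersD(1) Max_ge_1 in \<open>simp add: max_def\<close>)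
  also have "?g ?C = fps_X ^ 1 * weight_gf length avoiders (\<lambda>u. ?w (lift u))"
    by (rule weight_gf_image) (auto intro: inj_on_subset[OF inj_lift])
  also have "weight_gf length avoiders (\<lambda>u. ?w (lift u)) = v * R_gf v"
    unfolding R_gf_eq_weight_gf
    by (subst weight_gf_cmult[OF finite_levels_avoiders, symmetric]) (rule weight_gf_cong, rule lift_weight)
  also have "?g ?D = fps_X ^ 2 * weight_gf length avoiders (\<lambda>u. ?w (lift u @ [1]))"
    by (rule weight_gf_image) (auto simp: inj_on_def)
  also have "weight_gf length avoiders (\<lambda>u. ?w (lift u @ [1])) = v * R_gf v"
    unfolding R_gf_eq_weight_gf
    by (subst weight_gf_cmult[OF finite_levels_avoiders, symmetric]) (rule weight_gf_cong, rule lift_weight)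
  also have "?g ?E = fps_X ^ 2 * weight_gf (\<lambda>(u', u). length u' + length u) ?S
      (\<lambda>p. ?w ((\<lambda>(u', u). lift u @ lift u') p))"
  proof (rule weight_gf_image)
    show "inj_on (\<lambda>(u', u). lift u @ lift u') ?S"
    proof (rule inj_onI)
      fix p q
      assume p: "p \<in> ?S" and eq: "(\<lambda>(u', u). lift u @ lift u') p = (\<lambda>(u', u). lift u @ lift u') q"
      obtain u' u x' x where pq: "p = (u', u)" "q = (x', x)" by (metis surj_pair)
      have "u' \<in> avoiders" "u \<in> avoiders" using p avoiders_above_subset unfolding pq by auto
      then show "p = q" using eq lift_append_lift_eq_iff[of u u' x x'] unfolding pq by simp
    qed
  qed (simp add: case_prod_unfold)
  also have "weight_gf (\<lambda>(u', u). length u' + length u) ?S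
      (\<lambda>p. ?w ((\<lambda>(u', u). lift u @ lift u') p)) =
    weight_gf (\<lambda>(u', u). length u' + length u) ?S
      (\<lambda>(u', u). v * v ^ (max (Max (set u)) (Max (set u')) - 1))"
  proof (rule weight_gf_cong, clarify)
    fix u' u assume u': "u' \<in> avoiders" and "u \<in> avoiders_above (Max (set u'))"
    then have u: "u \<in> avoiders" using avoiders_above_subset by blast
    have "Max (set (lift u @ lift u')) = max (Suc (Max (set u))) (Suc (Max (set u')))"
    proof -
      have "Max (set (lift u) \<union> set (lift u')) = max (Max (set (lift u))) (Max (set (lift u')))"
        by (rule Max_Un) (simp_all add: lift_def)
      then show ?thesis
        unfolding Max_lift[OF avoidersD(1)[OF u]] Max_lift[OF avoidersD(1)[OF u']] set_append .
    qed
    also have "\<dots> - 1 = Suc (max (Max (set u)) (Max (set u')) - 1)"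
      using Max_ge_1[OF u] by (simp add: max_def)
    finally show "?w (lift u @ lift u') = v * v ^ (max (Max (set u)) (Max (set u')) - 1)"
      by simp
  qed
  also have "\<dots> = weight_gf length avoiders (\<lambda>u'. weight_gf length (avoiders_above (Max (set u')))
      (\<lambda>u. v * v ^ (max (Max (set u)) (Max (set u')) - 1)))"
    by (rule weight_gf_Sigma[OF finite_levels_avoiders finite_levels_avoiders_above])
  also have "\<dots> = v * weight_gf length avoiders (\<lambda>u. avoiders_above_gf v (Max (set u)))"
    unfolding weight_gf_cmult[OF finite_levels_avoiders_above] weight_gf_cmult[OF finite_levels_avoiders]
      avoiders_above_gf_def ..
  finally show ?thesis by (simp add: mult.assoc)
qed

definition geometric :: "'a::comm_ring_1 fps" where "geometric = Abs_fps (\<lambda>_. 1)"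

lemma geometric: "(1 - fps_X) * geometric = (1 :: 'a::comm_ring_1 fps)"
  by (rule fps_ext) (auto simp: geometric_def left_diff_distrib fps_X_mult_nth)

text \<open>
  The series \<open>t/(1 - t)\<close> of nonempty runs of one letter, written without division so that it makes
  sense over every commutative ring.
\<close>

definition run_gf :: "'a::comm_ring_1 fps" where "run_gf = fps_X * geometric"

lemma run_gf: "(1 - fps_X) * run_gf = fps_X"
  using geometric by (metis run_gf_def mult.left_commute mult.right_neutral)

lemma avoiders_above_gf_0: "avoiders_above_gf v 0 = R_gf v"
  by (simp add: avoiders_above_gf_def R_gf_eq_weight_gf avoiders_above_0)

lemma avoiders_above_gf_Suc: "avoiders_above_gf v (Suc m) = run_gf * (v ^ m + v * avoiders_above_gf v m)"
proof -
  let ?F = "avoiders_above_gf v (Suc m)"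
  have "(1 - fps_X) * ?F = fps_X * (v ^ m + v * avoiders_above_gf v m)"
    using avoiders_above_gf_Suc_peel[of v m] by (simp add: algebra_simps)
  then have "geometric * ((1 - fps_X) * ?F) = run_gf * (v ^ m + v * avoiders_above_gf v m)"
    by (simp add: run_gf_def mult_ac)
  moreover have "geometric * ((1 - fps_X) * ?F) = (1 - fps_X) * geometric * ?F" by (simp only: mult_ac)
  moreover have "(1 - fps_X) * geometric * ?F = ?F" by (simp only: geometric mult_1_left)
  ultimately show ?thesis by simp
qed

text \<open>
  The recursion \<open>avoiders_above_gf_Suc\<close> is an inhomogeneous linear one in \<open>m\<close>, with homogeneous
  solution \<open>(v s) ^ m\<close> and forcing term proportional to \<open>v ^ m\<close>; the factor \<open>1 - 2 t\<close> clears the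
  denominator of \<open>s/(1 - s) = t/(1 - 2 t)\<close> in the particular solution.
\<close>

lemma avoiders_above_gf_closed_form:
  fixes v :: "'a::comm_ring_1 fps"
  shows "(1 - 2 * fps_X) * avoiders_above_gf v (Suc m) = fps_X * v ^ m +
    ((1 - 2 * fps_X) * run_gf * (1 + v * R_gf v) - fps_X) * (v * run_gf) ^ m"
proof (induction m)
  case 0
  then show ?case by (simp add: avoiders_above_gf_Suc avoiders_above_gf_0 mult.assoc)
next
  case (Suc m)
  let ?Q = "(1 - 2 * fps_X) * run_gf * (1 + v * R_gf v) - fps_X"
  have "(1 - 2 * fps_X) * avoiders_above_gf v (Suc (Suc m)) =
      (1 - 2 * fps_X) * run_gf * v ^ Suc m + v * run_gf * ((1 - 2 * fps_X) * avoiders_above_gf v (Suc m))"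
    by (subst avoiders_above_gf_Suc) (simp add: algebra_simps)
  also have "\<dots> = ((1 - fps_X) * run_gf) * v ^ Suc m + ?Q * (v * run_gf) ^ Suc m"
    unfolding Suc.IH by (simp add: algebra_simps)
  finally show ?case by (simp only: run_gf)
qed

text \<open>
  In the closed form the maximum of the word occurs only as an exponent of \<open>v\<close> and of \<open>v s\<close>, so the
  sum over all words evaluates \<open>R_gf\<close> at these two arguments.
\<close>

lemma avoiders_above_gf_sum:
  fixes v :: "'a::comm_ring_1 fps"
  shows "(1 - 2 * fps_X) * weight_gf length avoiders (\<lambda>u. avoiders_above_gf v (Max (set u))) =
    fps_X * R_gf v +
    ((1 - 2 * fps_X) * run_gf * (1 + v * R_gf v) - fps_X) * R_gf (v * run_gf)"
proof -
  let ?Q = "(1 - 2 * fps_X) * run_gf * (1 + v * R_gf v) - fps_X"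
  have "(1 - 2 * fps_X) * weight_gf length avoiders (\<lambda>u. avoiders_above_gf v (Max (set u))) =
      weight_gf length avoiders (\<lambda>u. (1 - 2 * fps_X) * avoiders_above_gf v (Max (set u)))"
    by (rule weight_gf_cmult[OF finite_levels_avoiders, symmetric])
  also have "\<dots> = weight_gf length avoiders
      (\<lambda>u. fps_X * v ^ (Max (set u) - 1) + ?Q * (v * run_gf) ^ (Max (set u) - 1))"
  proof (rule weight_gf_cong)
    fix u assume "u \<in> avoiders"
    then have "Max (set u) = Suc (Max (set u) - 1)" using Max_ge_1 by fastforce
    then show "(1 - 2 * fps_X) * avoiders_above_gf v (Max (set u)) =
        fps_X * v ^ (Max (set u) - 1) + ?Q * (v * run_gf) ^ (Max (set u) - 1)"
      using avoiders_above_gf_closed_form[of v "Max (set u) - 1"] by simp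
  qed
  finally show ?thesis
    by (simp only: weight_gf_add weight_gf_cmult[OF finite_levels_avoiders] R_gf_eq_weight_gf)
qed

text \<open>
  This is \<open>R_peel\<close> with the inner sum eliminated by \<open>avoiders_above_gf_sum\<close>, multiplied by
  \<open>(1 - t) (1 - 2 t)\<close> to clear denominators.
\<close>

lemma R_gf_functional_equation:
  fixes v :: "'a::comm_ring_1 fps"
  defines "t \<equiv> fps_X" and "R' \<equiv> R_gf (v * run_gf)"
  shows "R_gf v * ((1 - t)^2 * (1 - 2 * t) - v * t * (1 - t) * (1 + t) * (1 - 2 * t)
           - v * t^3 * (1 - t) - v^2 * t^3 * (1 - 2 * t) * R') =
         t * ((1 - t) * (1 - 2 * t) - v * t^3 * R')"
proof -
  define P where "P = weight_gf length avoiders (\<lambda>u. avoiders_above_gf v (Max (set u)))"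
  define R where "R = R_gf v"
  define s :: "'a fps" where "s = run_gf"
  have s: "(1 - t) * s = t" unfolding s_def t_def by (rule run_gf)
  have R: "R = t + t * R + t * v * R + t^2 * v * R + t^2 * v * P"
    unfolding R_def P_def t_def by (rule R_peel)
  have P: "(1 - 2 * t) * P = t * R + ((1 - 2 * t) * s * (1 + v * R) - t) * R'"
    unfolding R_def P_def t_def R'_def s_def by (rule avoiders_above_gf_sum)
  \<comment> \<open>The multipliers of the equations for \<open>R\<close> and \<open>P\<close> eliminate \<open>P\<close>; that of the equation for \<open>s\<close>
    then eliminates \<open>s\<close>.\<close>
  have "R * ((1 - t)^2 * (1 - 2 * t) - v * t * (1 - t) * (1 + t) * (1 - 2 * t)
           - v * t^3 * (1 - t) - v^2 * t^3 * (1 - 2 * t) * R') -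
         t * ((1 - t) * (1 - 2 * t) - v * t^3 * R') =
      (1 - t) * (1 - 2 * t) * (R - (t + t * R + t * v * R + t^2 * v * R + t^2 * v * P)) +
      t^2 * v * (1 - t) *
        ((1 - 2 * t) * P - (t * R + ((1 - 2 * t) * s * (1 + v * R) - t) * R')) +
      t^2 * v * (1 - 2 * t) * (1 + v * R) * R' * ((1 - t) * s - t)"
    by (simp add: algebra_simps power2_eq_square power3_eq_cube)
  also have "\<dots> = 0" using s R P by simp
  finally show ?thesis unfolding R_def by simp
qed

section \<open>Initial coefficients\<close>

text \<open>
  In the functional equation, \<open>R_gf v\<close> has a coefficient of the form \<open>1 + t (...)\<close> while the other
  side is a multiple of \<open>t\<close>.
\<close>

lemma dvd_R_gf: "fps_X dvd (R_gf (v :: 'a::comm_ring_1 fps))"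
proof -
  let ?t = "fps_X :: 'a fps"
  let ?R = "R_gf v" and ?R' = "R_gf (v * run_gf)"
  have "?R = ?t * ((1 - ?t) * (1 - 2 * ?t) - v * ?t^3 * ?R' -
      ?R * (5 * ?t - 4 - 2 * ?t^2 - v * (1 - ?t) * (1 + ?t) * (1 - 2 * ?t)
           - v * ?t^2 * (1 - ?t) - v^2 * ?t^2 * (1 - 2 * ?t) * ?R'))"
    using R_gf_functional_equation[of v]
    by (simp add: algebra_simps power2_eq_square power3_eq_cube)
  then show ?thesis by (rule dvdI)
qed

lemma X_power_dvd_cancel_unit:
  fixes f g :: "'a::comm_ring_1 fps"
  assumes "fps_X ^ n dvd f * g" "g $ 0 = 1"
  shows "fps_X ^ n dvd f"
proof -
  have "g * fps_right_inverse g 1 = 1"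
    by (rule fps_right_inverse) (use assms in simp)
  then have "f = (f * g) * fps_right_inverse g 1" by (simp add: mult.assoc)
  then show ?thesis using assms(1) by (metis dvd_mult2)
qed

lemma X_power_dvd_fps_of_poly:
  assumes "\<forall>k\<in>set [0..<n]. coeff p k = (0 :: 'a::comm_ring_1)"
  shows "fps_X ^ n dvd fps_of_poly p"
proof -
  have "fps_of_poly p = fps_X ^ n * fps_shift n (fps_of_poly p)"
    by (rule fps_ext) (use assms in \<open>simp add: fps_X_power_mult_nth\<close>)
  then show ?thesis by (rule dvdI)
qed

abbreviation X where "X \<equiv> [:0, 1 :: int:]"

text \<open>
  Numerator and denominator of \<open>R(t;s ^ j)\<close> in terms of an approximation \<open>q\<close> of \<open>R(t;s ^ (j + 1))\<close>,
  according to the functional equation multiplied by \<open>(1 - t) ^ (2 j)\<close>. This factor turns the powers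
  of \<open>s = t/(1 - t)\<close> into polynomials.
\<close>

definition numer_poly :: "nat \<Rightarrow> int poly \<Rightarrow> int poly" where
  "numer_poly j q = X * (1 - X) ^ (2 * j + 1) * (1 - 2 * X) - X ^ (j + 4) * (1 - X) ^ j * q"

definition denom_poly :: "nat \<Rightarrow> int poly \<Rightarrow> int poly" where
  "denom_poly j q = (1 - X) ^ (2 * j + 2) * (1 - 2 * X)
     - X ^ (j + 1) * (1 - X) ^ (j + 1) * (1 + X) * (1 - 2 * X)
     - X ^ (j + 3) * (1 - X) ^ (j + 1) - X ^ (2 * j + 3) * (1 - 2 * X) * q"

text \<open>
  For \<open>v = s ^ j\<close>, \<open>w = (1 - t) ^ j\<close> and \<open>u = t ^ j\<close>, multiplying by \<open>w\<^sup>2\<close> leaves \<open>v\<close> only in the form \<open>v w\<close>.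
\<close>

lemma functional_equation_cleared:
  fixes R R' :: "'a::comm_ring_1"
  assumes "v * w = u"
    and "R * ((1 - t)^2 * (1 - 2 * t) - v * t * (1 - t) * (1 + t) * (1 - 2 * t)
           - v * t^3 * (1 - t) - v^2 * t^3 * (1 - 2 * t) * R') =
         t * ((1 - t) * (1 - 2 * t) - v * t^3 * R')"
  shows "R * (w^2 * (1 - t)^2 * (1 - 2 * t) - u * w * t * (1 - t) * (1 + t) * (1 - 2 * t)
           - u * w * t^3 * (1 - t) - u^2 * t^3 * (1 - 2 * t) * R') =
         t * (w^2 * (1 - t) * (1 - 2 * t) - u * w * t^3 * R')" (is "?L = ?M")
proof -
  have "?L - ?M = w^2 *
      (R * ((1 - t)^2 * (1 - 2 * t) - v * t * (1 - t) * (1 + t) * (1 - 2 * t)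
           - v * t^3 * (1 - t) - v^2 * t^3 * (1 - 2 * t) * R') -
         t * ((1 - t) * (1 - 2 * t) - v * t^3 * R'))"
    unfolding assms(1)[symmetric] by (simp add: algebra_simps power2_eq_square)
  then show ?thesis using assms(2) by simp
qed

text \<open>
  Replacing \<open>R(t;s ^ (j + 1))\<close> by \<open>q\<close> changes the cleared functional equation by a multiple of
  \<open>t ^ (j + 4)\<close> times the error of \<open>q\<close>: the coefficient \<open>t ^ (2 j + 3)\<close> in the denominator meets the
  factor \<open>t\<close> of \<open>R(t;s ^ j)\<close>. As the denominator has constant term \<open>1\<close>, the equation determines
  \<open>R(t;s ^ j)\<close> to that order, and a candidate \<open>p\<close> is confirmed by integer arithmetic.
\<close>

lemma truncation_step:
  fixes p q :: "int poly"
  assumes next_dvd: "fps_X ^ n dvd R_gf (run_gf ^ Suc j) - fps_of_poly q"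
    and check: "\<forall>k\<in>set [0..<m]. coeff (p * denom_poly j q - numer_poly j q) k = 0"
    and m: "m \<le> j + 4 + n"
  shows "fps_X ^ m dvd R_gf (run_gf ^ j) - fps_of_poly p"
proof -
  define t :: "int fps" where "t = fps_X"
  define R where "R = R_gf (run_gf ^ j :: int fps)"
  define R' where "R' = R_gf (run_gf ^ Suc j :: int fps)"
  define P where "P = fps_of_poly p"
  define Q where "Q = fps_of_poly q"
  define D where "D = fps_of_poly (denom_poly j q)"
  define N where "N = fps_of_poly (numer_poly j q)"
  define u where "u = t ^ j"
  define w where "w = (1 - t) ^ j"
  have X: "fps_of_poly X = t" by (simp add: t_def fps_of_poly_pCons)
  have sq: "x ^ (2 * j) = x ^ j * x ^ j" for x :: "int fps"
    by (simp add: mult_2 power_add)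
  have t4: "t ^ 4 = t * t ^ 3"
    by (simp add: numeral_eq_Suc)
  have D: "D = w^2 * (1 - t)^2 * (1 - 2 * t) - u * w * t * (1 - t) * (1 + t) * (1 - 2 * t)
           - u * w * t^3 * (1 - t) - u^2 * t^3 * (1 - 2 * t) * Q"
    unfolding D_def Q_def denom_poly_def fps_of_poly_diff fps_of_poly_add fps_of_poly_mult
        fps_of_poly_power fps_of_poly_1 fps_of_poly_numeral X u_def w_def
    by (simp only: power_add sq power2_eq_square power_one_right) (simp only: mult_ac)
  have N: "N = t * (w^2 * (1 - t) * (1 - 2 * t) - u * w * t^3 * Q)"
    unfolding N_def Q_def numer_poly_def fps_of_poly_diff fps_of_poly_add fps_of_poly_mult
        fps_of_poly_power fps_of_poly_1 fps_of_poly_numeral X u_def w_def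
    by (simp only: power_add sq t4 power2_eq_square power_one_right right_diff_distrib[of t])
       (simp only: mult_ac)
  have v: "run_gf ^ j * w = u"
    using run_gf unfolding w_def u_def t_def by (metis mult.commute power_mult_distrib)
  have cleared: "R * (w^2 * (1 - t)^2 * (1 - 2 * t) - u * w * t * (1 - t) * (1 + t) * (1 - 2 * t)
           - u * w * t^3 * (1 - t) - u^2 * t^3 * (1 - 2 * t) * R') =
         t * (w^2 * (1 - t) * (1 - 2 * t) - u * w * t^3 * R')"
    by (rule functional_equation_cleared[OF v])
       (use R_gf_functional_equation[of "run_gf ^ j :: int fps"] in
         \<open>simp only: R_def R'_def t_def power_Suc2\<close>)
  \<comment> \<open>The extra factor \<open>t\<close> of \<open>R\<close> raises \<open>u\<^sup>2 t\<^sup>3\<close> to a multiple of \<open>u t\<^sup>4\<close>, the other error term.\<close>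
  obtain R1 where R1: "R = t * R1"
    using dvd_R_gf[of "run_gf ^ j :: int fps"] unfolding R_def t_def by (elim dvdE)
  have "(R - P) * D = (u * t^4) * (R' - Q) * (R1 * u * (1 - 2 * t) - w) - (P * D - N) +
      (R * (w^2 * (1 - t)^2 * (1 - 2 * t) - u * w * t * (1 - t) * (1 + t) * (1 - 2 * t)
           - u * w * t^3 * (1 - t) - u^2 * t^3 * (1 - 2 * t) * R') -
         t * (w^2 * (1 - t) * (1 - 2 * t) - u * w * t^3 * R'))"
    unfolding D N R1 by (simp add: algebra_simps power2_eq_square numeral_eq_Suc)
  then have "(R - P) * D = (u * t^4) * (R' - Q) * (R1 * u * (1 - 2 * t) - w) - (P * D - N)"
    unfolding cleared by simp
  moreover have "t ^ m dvd (u * t^4) * (R' - Q) * (R1 * u * (1 - 2 * t) - w)"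
  proof -
    have "u * t^4 * t^n dvd u * t^4 * (R' - Q)"
      using next_dvd unfolding R'_def Q_def t_def by (intro mult_dvd_mono dvd_refl)
    moreover have "t ^ m dvd u * t^4 * t^n"
      unfolding u_def power_add[symmetric] by (rule le_imp_power_dvd[OF m])
    ultimately show ?thesis by (meson dvd_mult2 dvd_trans)
  qed
  moreover have "t ^ m dvd P * D - N"
    using X_power_dvd_fps_of_poly[OF check]
    unfolding t_def P_def D_def N_def fps_of_poly_diff fps_of_poly_mult .
  ultimately have "t ^ m dvd (R - P) * D" by (metis dvd_diff)
  moreover have "D $ 0 = 1"
    unfolding D by (simp add: t_def w_def u_def power2_eq_square fps_nth_power_0)
  ultimately show ?thesis
    unfolding t_def R_def P_def by (rule X_power_dvd_cancel_unit)
qed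

text \<open>
  The truncations of \<open>R(t;s ^ j)\<close> for \<open>j = 0, 1, 2, 3\<close>, to the orders \<open>21\<close>, \<open>17\<close>, \<open>12\<close> and \<open>6\<close>.
  With a gain of \<open>j + 4\<close> per step, order \<open>21\<close> at \<open>j = 0\<close> requires \<open>17\<close> at \<open>j = 1\<close>, then \<open>12\<close>, then
  \<open>6\<close>, and nothing at \<open>j = 4\<close>.
\<close>

definition trunc0 :: "int poly" where "trunc0 = [:0, 1, 2, 5, 13, 35, 96, 267, 750, 2122, 6036, 17239, 49389, 141842, 408142, 1176194,
      3393726, 9801731, 28331971, 81947397, 237152119:]"
definition trunc1 :: "int poly" where "trunc1 = [:0, 1, 1, 2, 5, 12, 28, 66, 158, 382, 929, 2269, 5563, 13688, 33791, 83661, 207648:]"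
definition trunc2 :: "int poly" where "trunc2 = [:0, 1, 1, 1, 2, 6, 16, 37, 80, 173, 386, 885:]"
definition trunc3 :: "int poly" where "trunc3 = [:0, 1, 1, 1, 1, 2:]"

lemma trunc3_check: "\<forall>k\<in>set [0..<6]. coeff (trunc3 * denom_poly 3 0 - numer_poly 3 0) k = 0"
  by code_simp

lemma trunc2_check: "\<forall>k\<in>set [0..<12]. coeff (trunc2 * denom_poly 2 trunc3 - numer_poly 2 trunc3) k = 0"
  by code_simp

lemma trunc1_check: "\<forall>k\<in>set [0..<17]. coeff (trunc1 * denom_poly 1 trunc2 - numer_poly 1 trunc2) k = 0"
  by code_simp

lemma trunc0_check: "\<forall>k\<in>set [0..<21]. coeff (trunc0 * denom_poly 0 trunc1 - numer_poly 0 trunc1) k = 0"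
  by code_simp

lemma R_gf_1_truncation: "fps_X ^ 21 dvd R_gf 1 - fps_of_poly trunc0"
proof -
  have "fps_X ^ 0 dvd R_gf (run_gf ^ Suc 3) - fps_of_poly (0 :: int poly)" by simp
  then have 3: "fps_X ^ 6 dvd R_gf (run_gf ^ 3) - fps_of_poly trunc3"
    by (rule truncation_step[OF _ trunc3_check]) simp
  have 2: "fps_X ^ 12 dvd R_gf (run_gf ^ 2) - fps_of_poly trunc2"
    by (rule truncation_step[OF _ trunc2_check, of 6]) (use 3 in simp_all)
  have 1: "fps_X ^ 17 dvd R_gf (run_gf ^ 1) - fps_of_poly trunc1"
    by (rule truncation_step[OF _ trunc1_check, of 12]) (use 2 in \<open>simp_all add: numeral_2_eq_2\<close>)
  have "fps_X ^ 21 dvd R_gf (run_gf ^ 0) - fps_of_poly trunc0"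
    by (rule truncation_step[OF _ trunc0_check, of 17]) (use 1 in simp_all)
  then show ?thesis by simp
qed

section \<open>The fraction over a field\<close>

lemma run_gf_eq: "(run_gf :: 'a::field fps) = fps_X / (1 - fps_X)"
proof -
  have "(1 - fps_X :: 'a fps) \<noteq> 0" by (metis fps_X_neq_one right_minus_eq)
  then show ?thesis using run_gf by (metis nonzero_mult_div_cancel_left)
qed

text \<open>
  Both denominators have constant term \<open>1\<close>, so the divisions of power series are exact. For the outer
  one, \<open>v (1 - 2 t)\<close> contributes \<open>v(0)\<close> and the subtracted fraction \<open>v(0) - 1\<close>.
\<close>

lemma R_gf_continued_fraction:
  fixes v :: "'a::field fps"
  defines "t \<equiv> fps_X"
  shows "R_gf v = t / (v * (1 - 2 * t) -
    ((1 - t)^2 * (v * t^2 - (1 - v) * (1 - 2 * t))) /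
      ((1 - t) * (1 - 2 * t) - v * t^3 * R_gf (v * t / (1 - t))))"
proof -
  define R' where "R' = R_gf (v * t / (1 - t))"
  define D where "D = (1 - t) * (1 - 2 * t) - v * t^3 * R'"
  define M where "M = (1 - t)^2 * (v * t^2 - (1 - v) * (1 - 2 * t))"
  define E where "E = v * (1 - 2 * t) - M / D"
  have t0: "t $ 0 = 0" by (simp add: t_def)
  have "(1 - t) $ 0 \<noteq> 0" by (simp add: t0)
  then have "v * t / (1 - t) = v * run_gf"
    unfolding run_gf_eq t_def by (simp add: fps_divide_unit mult.assoc)
  then have R': "R' = R_gf (v * run_gf)" by (simp add: R'_def)
  have D0: "D $ 0 = 1" by (simp add: D_def t0 power3_eq_cube)
  then have DM: "D * (M / D) = M"
    by (simp add: fps_divide_unit inverse_mult_eq_1' mult.left_commute)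
  have "(D * (M / D)) $ 0 = (M / D) $ 0" by (simp add: D0)
  moreover have "M $ 0 = v $ 0 - 1" by (simp add: M_def t0 power2_eq_square)
  ultimately have "(M / D) $ 0 = v $ 0 - 1" unfolding DM by simp
  then have E0: "E $ 0 = 1" by (simp add: E_def t0)
  have "D * (R_gf v * E) = R_gf v * (v * (1 - 2 * t) * D - D * (M / D))"
    by (simp add: E_def algebra_simps)
  also have "\<dots> = t * D"
    unfolding DM using R_gf_functional_equation[of v, folded t_def R']
    by (simp add: D_def M_def algebra_simps power2_eq_square power3_eq_cube)
  finally have "D * (R_gf v * E) = D * t" by (simp add: mult.commute)
  moreover have "D \<noteq> 0" using D0 by auto
  ultimately have "R_gf v * E = t" by simp
  then have "R_gf v = t / E"
    using E0 by (metis fps_nonzeroI nonzero_mult_div_cancel_right zero_neq_one)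
  then show ?thesis unfolding E_def M_def D_def R'_def .
qed

theorem theorem3p6:
  shows
    "(let t = fps_X; v = v_indet in
       R_gf v =
         t / (v * (1 - 2 * t) -
              ((1 - t)^2 * (v * t^2 - (1 - v) * (1 - 2 * t))) /
              ((1 - t) * (1 - 2 * t) - v * t^3 * R_gf (v * t / (1 - t)))))
     \<and>
     (\<Sum>n. of_nat (avoiding_count (Suc n)) * fps_X ^ Suc n) = (R_gf 1 :: int fps)
     \<and>
     fps_cutoff 21 (R_gf 1 :: int fps) =
       fps_X + 2 * fps_X^2 + 5 * fps_X^3 + 13 * fps_X^4 + 35 * fps_X^5 + 96 * fps_X^6
       + 267 * fps_X^7 + 750 * fps_X^8 + 2122 * fps_X^9 + 6036 * fps_X^10 + 17239 * fps_X^11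
       + 49389 * fps_X^12 + 141842 * fps_X^13 + 408142 * fps_X^14 + 1176194 * fps_X^15
       + 3393726 * fps_X^16 + 9801731 * fps_X^17 + 28331971 * fps_X^18 + 81947397 * fps_X^19
       + 237152119 * fps_X^20"
proof (intro conjI)
  show "let t = fps_X; v = v_indet in
       R_gf v =
         t / (v * (1 - 2 * t) -
              ((1 - t)^2 * (v * t^2 - (1 - v) * (1 - 2 * t))) /
              ((1 - t) * (1 - 2 * t) - v * t^3 * R_gf (v * t / (1 - t))))"
    unfolding Let_def by (rule R_gf_continued_fraction)
next
  show "(\<Sum>n. of_nat (avoiding_count (Suc n)) * fps_X ^ Suc n) = (R_gf 1 :: int fps)"
    unfolding R_gf_def avoiding_count_eq_sum
    by (simp only: of_nat_sum sum_distrib_right power_one mult_1_right)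
next
  obtain S where S: "R_gf 1 - fps_of_poly trunc0 = fps_X ^ 21 * S"
    using R_gf_1_truncation by (elim dvdE)
  then have "fps_cutoff 21 (R_gf 1) = fps_cutoff 21 (fps_of_poly trunc0 + fps_X ^ 21 * S)"
    by (metis add_diff_cancel_left' diff_add_cancel add.commute)
  also have "\<dots> = fps_of_poly trunc0"
    by (rule fps_ext) (simp add: fps_X_power_mult_nth coeff_eq_0 trunc0_def)
  also have "\<dots> = fps_X + 2 * fps_X^2 + 5 * fps_X^3 + 13 * fps_X^4 + 35 * fps_X^5 + 96 * fps_X^6
       + 267 * fps_X^7 + 750 * fps_X^8 + 2122 * fps_X^9 + 6036 * fps_X^10 + 17239 * fps_X^11
       + 49389 * fps_X^12 + 141842 * fps_X^13 + 408142 * fps_X^14 + 1176194 * fps_X^15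
       + 3393726 * fps_X^16 + 9801731 * fps_X^17 + 28331971 * fps_X^18 + 81947397 * fps_X^19
       + 237152119 * fps_X^20"
    by (simp add: trunc0_def fps_of_poly_pCons numeral_fps_const algebra_simps power_numeral_reduce numeral_eq_Suc)
  finally show "fps_cutoff 21 (R_gf 1 :: int fps) = \<dots>" .
qed

end
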